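(* Let $G$ be a graph and let $\mathcal{P} = \{\mathcal{P}(v) \colon v \in V_G\}$ be a family in which, for each $v \in V_G$, $\mathcal{P}(v)$ is a partition of the neighborhood $N_G(v)$. Then the following hold: (1) $\gamma(G \circ \mathcal{P}) = |V_G|$. (2) $\gamma_{\rm a}(G \circ \mathcal{P}) \ge |V_G|$. (3) $\gamma_{\rm a}(G \circ \mathcal{P}) \le |V_G| + \min\bigl\{ \min\{|\mathcal{P}(v)| \colon v \in V_G\},\ 1 + \min\{|A| \colon A \in \bigcup_{v \in V_G} \mathcal{P}(v)\} \bigr\}$.
   Context: Graphs are finite, simple, undirected, with nonempty vertex set; $V_G$ and $E_G$ are the vertex and edge sets of $G$ and $N_G(v)$ is the open neighborhood of $v$. A dominating set of $G$ is a set $D \subseteq V_G$ such that every vertex of $V_G \setminus D$ is adjacent to at least one vertex of $D$. The domination number $\gamma(G)$ is the minimum cardinality of a dominating set of $G$. An accurate dominating set of $G$ is a dominating set $D$ of $G$ such that no $|D|$-element subset of $V_G \setminus D$ is a dominating set of $G$; the accurate domination number $\gamma_{\rm a}(G)$ is the minimum cardinality of an accurate dominating set of $G$. Partitions consist of nonempty blocks (so the partition of the empty set is empty). The $\mathcal{P}$-corona $G \circ \mathcal{P}$ is the graph with vertex set $(V_G \times \{1\}) \cup \bigcup_{v \in V_G} (\{v\} \times \mathcal{P}(v))$ and edge set $\bigcup_{v \in V_G} \{(v,1)(v,A) \colon A \in \mathcal{P}(v)\} \cup \bigcup_{uv \in E_G} \{(v,A)(u,B) \colon u \in A \text{ and }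 v \in B\}$, where in the last set $A \in \mathcal{P}(v)$ and $B \in \mathcal{P}(u)$. The minimum over an empty set is interpreted as $+\infty$ (this occurs only for the minimum over blocks $A$, when $G$ has no edges). *)

theory Defs
  imports
    Graph_Theory.Pair_Digraph
    "HOL-Library.Disjoint_Sets"
    "HOL-Library.Extended_Nat"
begin

text \<open>
  Finite simple undirected graphs are rendered by \<^locale>\<open>pair_graph\<close>: finite, loop-free digraphs
  whose arcs are ordered pairs and whose arc relation is symmetric, so that an undirected edge
  is represented by the two arcs \<open>(u, v)\<close> and \<open>(v, u)\<close>.
\<close>

definition nbhd :: "'a pair_pre_digraph \<Rightarrow> 'a \<Rightarrow> 'a set" where
  "nbhd G v = {u. (v, u) \<in> parcs G}"

definition dominating :: "'a pair_pre_digraph \<Rightarrow> 'a set \<Rightarrow> bool" where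
  "dominating G D \<longleftrightarrow> D \<subseteq> pverts G \<and> (\<forall>v \<in> pverts G - D. \<exists>u \<in> D. (v, u) \<in> parcs G)"

definition accurate_dominating :: "'a pair_pre_digraph \<Rightarrow> 'a set \<Rightarrow> bool" where
  "accurate_dominating G D \<longleftrightarrow> dominating G D \<and>
     \<not> (\<exists>D'. D' \<subseteq> pverts G - D \<and> card D' = card D \<and> dominating G D')"

text \<open>
  In a finite graph the whole vertex set is dominating, and it is accurate dominating if it is
  nonempty, so both minima below are attained.
\<close>

definition domination_number :: "'a pair_pre_digraph \<Rightarrow> nat" where
  "domination_number G = Min (card ` {D. dominating G D})"

definition accurate_domination_number :: "'a pair_pre_digraph \<Rightarrow> nat" where
  "accurate_domination_number G = Min (card ` {D. accurate_dominating G D})"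

text \<open>The vertex \<open>(v, 1)\<close> of the corona is \<open>(v, One)\<close>; the vertex \<open>(v, A)\<close> is \<open>(v, Block A)\<close>.\<close>

datatype 'a label = One | Block "'a set"

text \<open>
  The first two sets of arcs are the two orientations of the edges between \<open>(v, 1)\<close> and \<open>(v, A)\<close>;
  the third set contains both orientations of each of its edges when \<open>G\<close> is symmetric.
\<close>

definition corona ::
  "'a pair_pre_digraph \<Rightarrow> ('a \<Rightarrow> 'a set set) \<Rightarrow> ('a \<times> 'a label) pair_pre_digraph" where
  "corona G P =
    \<lparr> pverts = (pverts G \<times> {One}) \<union> (\<Union>v \<in> pverts G. {v} \<times> Block ` P v),
      parcs =
        {((v, One), (v, Block A)) | v A. v \<in> pverts G \<and> A \<in> P v} \<union>
        {((v, Block A), (v, One)) | v A. v \<in> pverts G \<and> A \<in> P v} \<union>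
        {((v, Block A), (u, Block B)) | v u A B.
           (v, u) \<in> parcs G \<and> A \<in> P v \<and> B \<in> P u \<and> u \<in> A \<and> v \<in> B} \<rparr>"

lemma pair_graph_corona:
  assumes "pair_graph G"
    and "\<forall>v \<in> pverts G. partition_on (nbhd G v) (P v)"
  shows "pair_graph (corona G P)"
proof -
  interpret pair_graph G by fact
  have "finite (P v)" if "v \<in> pverts G" for v
  proof -
    have "nbhd G v \<subseteq> pverts G"
      by (auto simp: nbhd_def dest: in_arcsD2)
    then show ?thesis
      using that assms(2) finite_elements finite_subset pair_finite_verts by metis
  qed
  then have fin: "finite (pverts (corona G P))"
    by (auto simp: corona_def)
  have wf: "a \<in> pverts (corona G P) \<and> b \<in> pverts (corona G P)" if "(a, b) \<in> parcs (corona G P)" for a b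
    using that by (auto simp: corona_def dest: in_arcsD1 in_arcsD2)
  have "parcs (corona G P) \<subseteq> pverts (corona G P) \<times> pverts (corona G P)"
    using wf by auto
  then have fina: "finite (parcs (corona G P))"
    using fin finite_subset by blast
  have loop: "a \<noteq> b" if "(a, b) \<in> parcs (corona G P)" for a b
    using that pair_no_loops by (fastforce simp: corona_def)
  have "(b, a) \<in> parcs (corona G P)" if "(a, b) \<in> parcs (corona G P)" for a b
    using that pair_sym_arcs by (auto simp: corona_def symmetric_def elim: symE)
  then have "sym (parcs (corona G P))"
    by (auto intro: symI)
  then show ?thesis
    using wf fin fina loop by unfold_locales (auto simp: symmetric_def)
qed

end

theory Submission
  imports Defs
begin

text \<open>
  The closed neighbourhoods of the vertices \<open>(v, 1)\<close> are the pairwise disjoint fibres of the first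
  projection, so a dominating set meets all of them, while \<open>V\<^sub>G \<times> {1}\<close> is dominating. A dominating
  set that contains a closed neighbourhood \<open>N[x]\<close> is accurate, since no set disjoint from \<open>N[x]\<close>
  dominates \<open>x\<close>. Adding to \<open>V\<^sub>G \<times> {1}\<close> the closed neighbourhood of \<open>(v, 1)\<close>, respectively of
  \<open>(v, A)\<close>, costs at most \<open>\<bar>P(v)\<bar>\<close>, respectively \<open>1 + \<bar>A\<bar>\<close>, vertices.
\<close>

lemma domination_number_eqI:
  assumes "finite (pverts H)" "dominating H D" "card D = n"
    and "\<And>D'. dominating H D' \<Longrightarrow> n \<le> card D'"
  shows "domination_number H = n"
proof -
  have "{D. dominating H D} \<subseteq> Pow (pverts H)"
    by (auto simp: dominating_def)
  then have "finite {D. dominating H D}"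
    using assms(1) by (simp add: finite_subset)
  then show ?thesis
    unfolding domination_number_def using assms(2-4) by (intro Min_eqI) auto
qed

lemma finite_accurate_dominating:
  assumes "finite (pverts H)"
  shows "finite {D. accurate_dominating H D}"
proof (rule finite_subset)
  show "{D. accurate_dominating H D} \<subseteq> Pow (pverts H)"
    by (auto simp: accurate_dominating_def dominating_def)
qed (simp add: assms)

lemma accurate_domination_number_le:
  assumes "finite (pverts H)" "accurate_dominating H D"
  shows "accurate_domination_number H \<le> card D"
  unfolding accurate_domination_number_def
  using finite_accurate_dominating[OF assms(1)] assms(2) by (intro Min_le) auto

text \<open>The witness \<open>D\<close> keeps the family nonempty: \<open>Min\<close> of an empty
  set is unspecified, so the bound on each member would say nothing about it.\<close>

lemma accurate_domination_number_ge:
  assumes "finite (pverts H)" "accurate_dominating H D"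
    and "\<And>D'. dominating H D' \<Longrightarrow> n \<le> card D'"
  shows "n \<le> accurate_domination_number H"
proof -
  have "n \<le> card D'" if "accurate_dominating H D'" for D'
    using assms(3) that by (simp add: accurate_dominating_def)
  then show ?thesis
    unfolding accurate_domination_number_def
    using finite_accurate_dominating[OF assms(1)] assms(2) by (subst Min_ge_iff) auto
qed

lemma accurate_dominating_if_closed_nbhd:
  assumes "dominating H D" "x \<in> pverts H" "insert x (nbhd H x) \<subseteq> D"
  shows "accurate_dominating H D"
  using assms unfolding accurate_dominating_def dominating_def nbhd_def by blast

lemma dominating_mono:
  assumes "dominating H D" "D \<subseteq> D'" "D' \<subseteq> pverts H"
  shows "dominating H D'"
  using assms unfolding dominating_def by blast

text \<open>Enlarging a dominating set keeps it dominating, so \<open>X\<close> only has to supply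
  what \<open>D\<close> lacks of one closed neighbourhood. Overlap of \<open>X\<close> with
  \<open>D\<close> is harmless, since only an upper bound on the union is wanted.\<close>

lemma accurate_domination_number_le_insert_nbhd:
  assumes "finite (pverts H)" "dominating H D" "x \<in> pverts H"
    and "insert x (nbhd H x) \<subseteq> D \<union> X" "X \<subseteq> pverts H"
  shows "accurate_domination_number H \<le> card D + card X"
proof -
  have "D \<subseteq> pverts H"
    using assms(2) by (simp add: dominating_def)
  then have "accurate_dominating H (D \<union> X)"
    using assms by (intro accurate_dominating_if_closed_nbhd[of _ _ x])
      (auto intro: dominating_mono)
  then show ?thesis
    using accurate_domination_number_le[OF assms(1)] card_Un_le le_trans by blast
qed

lemma dominating_corona_One: "dominating (corona G P) (pverts G \<times> {One})"
  by (auto simp: dominating_def corona_def)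

lemma nbhd_corona_One:
  assumes "v \<in> pverts G"
  shows "nbhd (corona G P) (v, One) = {v} \<times> Block ` P v"
  using assms by (auto simp: nbhd_def corona_def)

text \<open>Isolates the condition \<open>v \<in> B\<close>: when \<open>P u\<close> is a partition,
  it leaves at most one neighbour over each \<open>u \<in> A\<close>.\<close>

lemma nbhd_corona_Block_subset:
  "nbhd (corona G P) (v, Block A) \<subseteq>
     insert (v, One) {(u, Block B) | u B. u \<in> A \<and> (v, u) \<in> parcs G \<and> B \<in> P u \<and> v \<in> B}"
  by (auto simp: nbhd_def corona_def)

lemma card_dominating_corona:
  assumes "finite D" "dominating (corona G P) D"
  shows "card (pverts G) \<le> card D"
proof -
  have "pverts G \<subseteq> fst ` D"
  proof
    fix v assume v: "v \<in> pverts G"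
    then have "(v, One) \<in> pverts (corona G P)"
      by (simp add: corona_def)
    \<comment> \<open>Either \<open>(v, One)\<close> lies in \<open>D\<close> or one of its
      neighbours does; all of these have first coordinate \<open>v\<close>.\<close>
    then have "D \<inter> insert (v, One) (nbhd (corona G P) (v, One)) \<noteq> {}"
      using assms(2) unfolding dominating_def nbhd_def by blast
    then show "v \<in> fst ` D"
      unfolding nbhd_corona_One[OF v] by force
  qed
  then show ?thesis
    using assms(1) by (rule surj_card_le[rotated])
qed

lemma accurate_domination_number_corona_le_card_partition:
  assumes "pair_graph (corona G P)" "v \<in> pverts G"
  shows "accurate_domination_number (corona G P) \<le> card (pverts G) + card (P v)"
proof -
  interpret C: pair_graph "corona G P" by fact
  have "inj_on Block (P v)"
    by (auto intro: inj_onI)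
  then have "card ({v} \<times> Block ` P v) = card (P v)"
    by (simp add: card_cartesian_product card_image)
  moreover have "accurate_domination_number (corona G P) \<le>
      card (pverts G \<times> {One :: 'a label}) + card ({v} \<times> Block ` P v)"
  proof (rule accurate_domination_number_le_insert_nbhd)
    show "(v, One) \<in> pverts (corona G P)" "{v} \<times> Block ` P v \<subseteq> pverts (corona G P)"
      using assms(2) by (auto simp: corona_def)
    show "insert (v, One) (nbhd (corona G P) (v, One)) \<subseteq> pverts G \<times> {One} \<union> {v} \<times> Block ` P v"
      using assms(2) by (auto simp: nbhd_corona_One)
  qed (fact C.pair_finite_verts dominating_corona_One)+
  ultimately show ?thesis
    by (simp add: card_cartesian_product)
qed

text \<open>For \<open>u \<in> A\<close>, symmetry of \<open>G\<close> puts \<open>v\<close> in the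
  neighbourhood of \<open>u\<close>, so exactly one block of \<open>P u\<close> contains
  \<open>v\<close>. Apart from \<open>(v, One)\<close>, the closed neighbourhood of
  \<open>(v, Block A)\<close> thus has one vertex over each \<open>u \<in> A\<close>, plus
  \<open>(v, Block A)\<close> itself.\<close>

lemma accurate_domination_number_corona_le_card_block:
  assumes "pair_graph G" "\<forall>v \<in> pverts G. partition_on (nbhd G v) (P v)"
    and v: "v \<in> pverts G" and A: "A \<in> P v"
  shows "accurate_domination_number (corona G P) \<le> card (pverts G) + (1 + card A)"
proof -
  interpret G: pair_graph G by fact
  interpret C: pair_graph "corona G P"
    using assms(1,2) by (rule pair_graph_corona)
  have A_sub: "A \<subseteq> nbhd G v"
    using assms partition_onD1 by blast
  have nbhd_sub: "nbhd G v \<subseteq> pverts G"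
    by (auto simp: nbhd_def dest: G.in_arcsD2)
  have fin: "finite A"
    using A_sub nbhd_sub G.pair_finite_verts by (meson finite_subset)
  have "\<exists>B. B \<in> P u \<and> v \<in> B \<and> (\<forall>B'\<in>P u. v \<in> B' \<longrightarrow> B' = B)" if "u \<in> A" for u
  proof -
    have "(v, u) \<in> parcs G"
      using that A_sub by (auto simp: nbhd_def)
    then have u: "u \<in> pverts G" "v \<in> nbhd G u"
      using G.in_arcsD2 G.arcs_symmetric by (auto simp: nbhd_def)
    then have "\<Union> (P u) = nbhd G u" and dis: "disjoint (P u)"
      using assms(2) by (auto simp: partition_on_def)
    then obtain B where "B \<in> P u" "v \<in> B"
      using u(2) by blast
    moreover have "B' = B" if "B' \<in> P u" "v \<in> B'" for B'
      using disjointD[OF dis that(1) \<open>B \<in> P u\<close>] that(2) \<open>v \<in> B\<close> by blast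
    ultimately show ?thesis
      by blast
  qed
  \<comment> \<open>\<open>b u\<close> is the block of \<open>P u\<close> that contains
    \<open>v\<close>.\<close>
  then obtain b where b: "\<And>u. u \<in> A \<Longrightarrow> b u \<in> P u"
      "\<And>u B'. u \<in> A \<Longrightarrow> B' \<in> P u \<Longrightarrow> v \<in> B' \<Longrightarrow> B' = b u"
    by metis
  define X where "X = insert (v, Block A) ((\<lambda>u. (u, Block (b u))) ` A)"
  have "card X \<le> 1 + card A"
    unfolding X_def using fin card_image_le[OF fin, of "\<lambda>u. (u, Block (b u))"]
    by (auto simp: card_insert_if)
  moreover have "accurate_domination_number (corona G P) \<le>
      card (pverts G \<times> {One :: 'a label}) + card X"
  proof (rule accurate_domination_number_le_insert_nbhd)
    show "(v, Block A) \<in> pverts (corona G P)"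
      using v A by (auto simp: corona_def)
    show "X \<subseteq> pverts (corona G P)"
      using v A b(1) A_sub nbhd_sub by (auto simp: X_def corona_def)
    \<comment> \<open>The neighbour \<open>(v, One)\<close> is already in the base set; any other
      neighbour \<open>(u, Block B)\<close> has \<open>B = b u\<close> by uniqueness.\<close>
    show "insert (v, Block A) (nbhd (corona G P) (v, Block A)) \<subseteq> pverts G \<times> {One} \<union> X"
      using nbhd_corona_Block_subset[of G P v A] v b(2) by (fastforce simp: X_def)
  qed (fact C.pair_finite_verts dominating_corona_One)+
  ultimately show ?thesis
    by (simp add: card_cartesian_product)
qed

text \<open>A nonempty infimum in \<open>enat\<close> is attained by well-ordering, while the empty
  one is \<infinity>. The empty case is needed for the blocks of an edgeless graph.\<close>

lemma enat_le_add_INF: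
  assumes "\<And>x. x \<in> S \<Longrightarrow> m \<le> k + f x"
  shows "enat m \<le> enat k + (INF x \<in> S. enat (f x))"
proof (cases "S = {}")
  case False
  then obtain x where "x \<in> S" "(INF x \<in> S. enat (f x)) = enat (f x)"
    using wellorder_InfI[of _ "(\<lambda>x. enat (f x)) ` S"] by blast
  then show ?thesis
    using assms by simp
qed (simp add: top_enat_def)

theorem theorem3:
  fixes G :: "'a pair_pre_digraph" and P :: "'a \<Rightarrow> 'a set set"
  assumes "pair_graph G"
    and "pverts G \<noteq> {}"
    and "\<forall>v \<in> pverts G. partition_on (nbhd G v) (P v)"
  shows "domination_number (corona G P) = card (pverts G) \<and>
         accurate_domination_number (corona G P) \<ge> card (pverts G) \<and>
         enat (accurate_domination_number (corona G P)) \<le> enat (card (pverts G)) +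
           min (INF v \<in> pverts G. enat (card (P v)))
               (1 + (INF A \<in> (\<Union>v \<in> pverts G. P v). enat (card A)))"
proof -
  let ?C = "corona G P" and ?n = "card (pverts G)"
  have pg: "pair_graph ?C"
    using assms(1,3) by (rule pair_graph_corona)
  interpret C: pair_graph ?C by fact
  note fin = C.pair_finite_verts
  have lower: "?n \<le> card D" if "dominating ?C D" for D
    using that card_dominating_corona finite_subset[OF _ fin] by (auto simp: dominating_def)
  have gamma: "domination_number ?C = ?n"
    using fin dominating_corona_One _ lower
    by (rule domination_number_eqI) (simp add: card_cartesian_product)
  \<comment> \<open>The whole vertex set contains every closed neighbourhood, so a single vertex
    makes it accurate and shows that the minimum ranges over a nonempty family.\<close>
  obtain x where "x \<in> pverts ?C"
    using assms(2) by (auto simp: corona_def)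
  then have "accurate_dominating ?C (pverts ?C)"
    by (intro accurate_dominating_if_closed_nbhd[of _ _ x])
      (auto simp: dominating_def nbhd_def dest: C.in_arcsD2)
  then have ge: "?n \<le> accurate_domination_number ?C"
    using fin lower by (intro accurate_domination_number_ge)
  have partition: "enat (accurate_domination_number ?C) \<le>
      enat ?n + (INF v \<in> pverts G. enat (card (P v)))"
    using accurate_domination_number_corona_le_card_partition[OF pg] by (rule enat_le_add_INF)
  \<comment> \<open>The summand 1 is first absorbed into the finite constant, to fit the shape of
    \<open>enat_le_add_INF\<close>, and then moved back by associativity.\<close>
  have "enat (accurate_domination_number ?C) \<le>
      enat (?n + 1) + (INF A \<in> (\<Union>v \<in> pverts G. P v). enat (card A))"
    using accurate_domination_number_corona_le_card_block[OF assms(1,3)]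
    by (intro enat_le_add_INF) auto
  also have "\<dots> = enat ?n + (1 + (INF A \<in> (\<Union>v \<in> pverts G. P v). enat (card A)))"
    by (simp only: plus_enat_simps(1)[symmetric] one_enat_def[symmetric] add.assoc)
  finally show ?thesis
    using gamma ge partition by (simp add: min_def)
qed

end
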